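(* Let $m>0$ and $g<0$, and let $V(q)=-\dfrac{m}{|q|}-g q_1^2-g\dfrac{q_2^2}{4}$ on $\mathbb{R}^2\setminus\{0\}$ (the potential of the frozen Hill's problem with centrifugal correction). Then for every negative energy $-f$ (i.e. every $f>0$), the energy hypersurface $\{H=-f\}$ of $H(p,q)=\frac{|p|^2}{2}+V(q)$, after Levi-Civita regularization, i.e. the hypersurface $\{K=m\}$, bounds a convex toric domain.
   Context: Levi-Civita regularization: identify $\mathbb{R}^2\cong\mathbb{C}$. The shifted Hamiltonian $H+f$ and its zero level are pulled back by the map $(z,w)\mapsto (q=z^2,\ p=\frac{w}{2\bar z})$ and multiplied by $|z|^2$ (a time reparametrization). With $z=z_1+iz_2$, $w=w_1+iw_2$, the energy level $\{H=-f\}$ becomes the level $\{K=m\}$ in $\mathbb{R}^4$ (extended smoothly over $z=0$), where $$K=\frac{|w|^2}{8}+f(z_1^2+z_2^2)-g(z_1^6+z_2^6)=K_1(z_1,w_1)+K_2(z_2,w_2),\qquad K_i=\frac{w_i^2}{8}+f z_i^2-g z_i^6 .$$ Action variables: for $a,b\ge 0$ with $a+b=m$, let $I_1(a)=\frac{1}{2\pi}\int_{\{K_1=a\}}w_1\,dz_1$ and $I_2(b)=\frac{1}{2\pi}\int_{\{K_2=b\}}w_2\,dz_2$ be $\frac1{2\pi}$ times the areas enclosed by the closed curves $\{K_1=a\}$ and $\{K_2=b\}$ in the $(z_1,w_1)$- and $(z_2,w_2)$-planes (with $I_i(0)=0$). The moment map image of $\{K=m\}$ is the curve $\{(I_1(a),I_2(m-a)):0\le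 a\le m\}$ in the quadrant $\{I_1\ge 0, I_2\ge 0\}$, connecting the two axes. The hypersurface is said to bound a concave toric domain if this curve is the graph $I_2=\varphi(I_1)$ of a smooth non-increasing convex function $\varphi$, and a convex toric domain if it is the graph of a smooth non-increasing concave function. *)

theory Defs
  imports "HOL-Analysis.Analysis"
begin

text \<open>Positions and momenta in the plane are complex numbers, \<open>q = q\<^sub>1 + i q\<^sub>2\<close> and
  \<open>p = p\<^sub>1 + i p\<^sub>2\<close>. The potential is only meaningful for \<open>q \<noteq> 0\<close>.\<close>

definition hill_potential :: "real \<Rightarrow> real \<Rightarrow> complex \<Rightarrow> real" where
  "hill_potential m g q = - m / norm q - g * (Re q)\<^sup>2 - g * ((Im q)\<^sup>2 / 4)"

definition hill_hamiltonian :: "real \<Rightarrow> real \<Rightarrow> complex \<Rightarrow> complex \<Rightarrow> real" where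
  "hill_hamiltonian m g p q = (norm p)\<^sup>2 / 2 + hill_potential m g q"

subsection \<open>Levi-Civita regularization\<close>

text \<open>The value of \<open>|z|\<^sup>2 (H - E)\<close> pulled back by \<open>q = z\<^sup>2\<close>, \<open>p = w / (2 cnj z)\<close>, for
  \<open>z \<noteq> 0\<close>.\<close>

definition levi_civita_pullback ::
    "(complex \<Rightarrow> complex \<Rightarrow> real) \<Rightarrow> real \<Rightarrow> complex \<times> complex \<Rightarrow> real" where
  "levi_civita_pullback H E = (\<lambda>(z, w). (norm z)\<^sup>2 * (H (w / (2 * cnj z)) (z\<^sup>2) - E))"

text \<open>The pullback is extended over \<open>z = 0\<close> by its limit from \<open>z \<noteq> 0\<close>.\<close>

definition levi_civita_hamiltonian ::
    "(complex \<Rightarrow> complex \<Rightarrow> real) \<Rightarrow> real \<Rightarrow> complex \<times> complex \<Rightarrow> real" where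
  "levi_civita_hamiltonian H E x =
     (if fst x \<noteq> 0 then levi_civita_pullback H E x
      else Lim (at x within {y. fst y \<noteq> 0}) (levi_civita_pullback H E))"

definition regularized_energy_level ::
    "(complex \<Rightarrow> complex \<Rightarrow> real) \<Rightarrow> real \<Rightarrow> (complex \<times> complex) set" where
  "regularized_energy_level H E = {x. levi_civita_hamiltonian H E x = 0}"

definition hill_K :: "real \<Rightarrow> real \<Rightarrow> complex \<times> complex \<Rightarrow> real" where
  "hill_K f g = (\<lambda>(z, w). (norm w)\<^sup>2 / 8 + f * ((Re z)\<^sup>2 + (Im z)\<^sup>2)
                          - g * ((Re z)^6 + (Im z)^6))"

text \<open>\<open>K\<^sub>1\<close> and \<open>K\<^sub>2\<close> are the same function, applied to \<open>(z\<^sub>1, w\<^sub>1)\<close> and \<open>(z\<^sub>2, w\<^sub>2)\<close>.\<close>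

definition hill_K_part :: "real \<Rightarrow> real \<Rightarrow> real \<times> real \<Rightarrow> real" where
  "hill_K_part f g = (\<lambda>(z, w). w\<^sup>2 / 8 + f * z\<^sup>2 - g * z^6)"

subsection \<open>Action variables and toric domains\<close>

text \<open>\<open>1 / (2 \<pi>)\<close> times the area enclosed by the curve \<open>{F = a}\<close>, that is, the area of the
  union of the bounded components of its complement. If \<open>{F = a}\<close> is a single point, nothing
  is enclosed and the action is \<open>0\<close>.\<close>

definition action :: "(real \<times> real \<Rightarrow> real) \<Rightarrow> real \<Rightarrow> real" where
  "action F a = measure lborel (inside {x. F x = a}) / (2 * pi)"

definition moment_map ::
    "(real \<times> real \<Rightarrow> real) \<Rightarrow> (real \<times> real \<Rightarrow> real) \<Rightarrow> complex \<times> complex \<Rightarrow> real \<times> real" where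
  "moment_map K1 K2 =
     (\<lambda>(z, w). (action K1 (K1 (Re z, Re w)), action K2 (K2 (Im z, Im w))))"

text \<open>A function is \<open>C\<^sup>\<infinity>\<close> on a possibly non-open set, such as a compact interval, if it is
  the restriction of a \<open>C\<^sup>\<infinity>\<close> function on an open neighbourhood; for an interval this means
  smoothness up to and including the end points.\<close>

definition smooth_fun_on :: "real set \<Rightarrow> (real \<Rightarrow> real) \<Rightarrow> bool" where
  "smooth_fun_on S \<phi> \<longleftrightarrow>
     (\<exists>U \<psi>. open U \<and> S \<subseteq> U \<and> (\<forall>x\<in>S. \<psi> x = \<phi> x) \<and>
            (\<forall>n. \<forall>x\<in>U. (deriv ^^ n) \<psi> differentiable at x))"

text \<open>The hypersurface \<open>S\<close> is meant to be a level set of \<open>K\<^sub>1(z\<^sub>1, w\<^sub>1) + K\<^sub>2(z\<^sub>2, w\<^sub>2)\<close>.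
  The condition \<open>\<phi> c = 0\<close> says that the graph, which starts on the axis \<open>I\<^sub>1 = 0\<close>, ends on
  the axis \<open>I\<^sub>2 = 0\<close>.\<close>

definition bounds_convex_toric_domain ::
    "(real \<times> real \<Rightarrow> real) \<Rightarrow> (real \<times> real \<Rightarrow> real) \<Rightarrow> (complex \<times> complex) set \<Rightarrow> bool" where
  "bounds_convex_toric_domain K1 K2 S \<longleftrightarrow>
     (\<exists>c \<phi>. 0 < c \<and> \<phi> c = 0 \<and>
        smooth_fun_on {0..c} \<phi> \<and> antimono_on {0..c} \<phi> \<and> concave_on {0..c} \<phi> \<and>
        moment_map K1 K2 ` S = {(x, \<phi> x) | x. x \<in> {0..c}})"

subsection \<open>Consistency of the definitions\<close>

lemma hill_K_separates:
  "hill_K f g (z, w) = hill_K_part f g (Re z, Re w) + hill_K_part f g (Im z, Im w)"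
  by (simp add: hill_K_def hill_K_part_def cmod_power2 algebra_simps add_divide_distrib)

lemma levi_civita_pullback_hill:
  assumes "z \<noteq> 0"
  shows "levi_civita_pullback (hill_hamiltonian m g) (- f) (z, w) = hill_K f g (z, w) - m"
proof -
  define a b where "a = Re z" and "b = Im z"
  have nz: "(norm z)\<^sup>2 = a\<^sup>2 + b\<^sup>2"
    by (simp add: cmod_power2 a_def b_def)
  have pos: "norm z \<noteq> 0"
    using assms by simp
  have kin: "(norm z)\<^sup>2 * ((norm (w / (2 * cnj z)))\<^sup>2 / 2) = (norm w)\<^sup>2 / 8"
    using pos by (simp add: norm_divide norm_mult power_divide power_mult_distrib field_simps)
  have coul: "(norm z)\<^sup>2 * (m / norm (z\<^sup>2)) = m"
    using pos by (simp add: norm_power)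
  have re: "Re (z\<^sup>2) = a\<^sup>2 - b\<^sup>2" and im: "Im (z\<^sup>2) = 2 * a * b"
    by (simp_all add: power2_eq_square a_def b_def)
  have sext: "(a\<^sup>2 + b\<^sup>2) * ((a\<^sup>2 - b\<^sup>2)\<^sup>2 + (2 * a * b)\<^sup>2 / 4) = a^6 + b^6"
    by (simp add: field_simps power2_eq_square eval_nat_numeral)
  have "levi_civita_pullback (hill_hamiltonian m g) (- f) (z, w) =
      (norm z)\<^sup>2 * ((norm (w / (2 * cnj z)))\<^sup>2 / 2) - (norm z)\<^sup>2 * (m / norm (z\<^sup>2))
      - g * ((norm z)\<^sup>2 * ((Re (z\<^sup>2))\<^sup>2 + (Im (z\<^sup>2))\<^sup>2 / 4)) + f * (norm z)\<^sup>2"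
    by (simp add: levi_civita_pullback_def hill_hamiltonian_def hill_potential_def algebra_simps)
  also have "\<dots> = (norm w)\<^sup>2 / 8 - m - g * (a^6 + b^6) + f * (a\<^sup>2 + b\<^sup>2)"
    by (simp only: kin coul re im sext, simp only: nz sext)
  finally show ?thesis
    by (simp add: hill_K_def a_def b_def)
qed

lemma moment_image_hill:
  assumes "f > 0" "g < 0" "m > 0"
  shows "moment_map (hill_K_part f g) (hill_K_part f g) ` {x. hill_K f g x = m} =
    {(action (hill_K_part f g) a, action (hill_K_part f g) (m - a)) | a. 0 \<le> a \<and> a \<le> m}"
    (is "?L = ?R")
proof
  have nonneg: "hill_K_part f g x \<ge> 0" for x
  proof -
    have "g * (fst x)^6 \<le> 0" "f * (fst x)\<^sup>2 \<ge> 0"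
      using assms by (simp_all add: mult_le_0_iff)
    moreover have "(snd x)\<^sup>2 / 8 \<ge> 0"
      by simp
    ultimately show ?thesis
      unfolding hill_K_part_def case_prod_beta by linarith
  qed
  show "?L \<subseteq> ?R"
  proof
    fix y assume "y \<in> ?L"
    then obtain z w where zw: "hill_K f g (z, w) = m"
      and y: "y = moment_map (hill_K_part f g) (hill_K_part f g) (z, w)"
      by auto
    define a where "a = hill_K_part f g (Re z, Re w)"
    have b: "hill_K_part f g (Im z, Im w) = m - a"
      using zw by (simp add: hill_K_separates a_def)
    have "0 \<le> a" "a \<le> m"
      using nonneg[of "(Re z, Re w)"] nonneg[of "(Im z, Im w)"] b by (simp_all add: a_def)
    then show "y \<in> ?R"
      using b by (auto simp: y moment_map_def a_def)
  qed
  show "?R \<subseteq> ?L"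
  proof
    fix y assume "y \<in> ?R"
    then obtain a where a: "0 \<le> a" "a \<le> m"
      and y: "y = (action (hill_K_part f g) a, action (hill_K_part f g) (m - a))"
      by auto
    define w where "w = Complex (sqrt (8 * a)) (sqrt (8 * (m - a)))"
    have "hill_K_part f g (0, Re w) = a" "hill_K_part f g (0, Im w) = m - a"
      using a by (simp_all add: hill_K_part_def w_def)
    then have "hill_K f g (0, w) = m"
      and "moment_map (hill_K_part f g) (hill_K_part f g) (0, w) = y"
      by (simp_all add: hill_K_separates moment_map_def y)
    then show "y \<in> ?L"
      by (metis (mono_tags, lifting) image_eqI mem_Collect_eq)
  qed
qed

end

theory Submission
  imports Defs
begin

text \<open>Both degrees of freedom have the energy \<open>K(z, w) = w\<^sup>2/8 + f z\<^sup>2 - g z\<^sup>6\<close>, hence the same action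
  \<open>I\<close>, and the moment image is the curve of the points \<open>(I a, I (m - a))\<close> with \<open>0 \<le> a \<le> m\<close>. As a
  graph over the first axis it has the slope \<open>- I' (m - a) / I' a\<close>. It is therefore enough to know
  that \<open>I\<close> is smooth up to the energy \<open>0\<close>, has a positive derivative, and that this derivative,
  the period of the oscillation divided by \<open>2 \<pi>\<close>, decreases with the energy: for \<open>g < 0\<close> the
  sextic term stiffens the spring.

  To see this, introduce the coordinate \<open>u\<close> with \<open>u\<^sup>2 = f z\<^sup>2 - g z\<^sup>6\<close> that has the sign of \<open>z\<close>.
  It makes the well harmonic at the cost of the density \<open>dz/du\<close>. This density is even in \<open>u\<close> and
  equals \<open>stretch (u\<^sup>2)\<close> for a function \<open>stretch\<close> that is smooth on the whole line, because the
  cubic \<open>y \<mapsto> f y - g y\<^sup>3\<close> is a diffeomorphism of the line. With \<open>u = \<surd>a sin t\<close> the enclosed area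
  becomes \<open>4 \<surd>2 a \<integral> cos\<^sup>2 t stretch (a sin\<^sup>2 t) dt\<close>, integrated over \<open>- \<pi>/2 \<le> t \<le> \<pi>/2\<close>
  (\<open>has_integral_area\<close>, \<open>emeasure_sublevel\<close>), which is smooth in \<open>a\<close> also at \<open>0\<close>. An integration by parts gives the
  period \<open>2 \<surd>2 \<integral> stretch (a sin\<^sup>2 t) dt\<close> (\<open>area_deriv\<close>). It is positive, and it decreases since
  \<open>stretch\<close> decreases on the nonnegative half line (\<open>stretch_antimono\<close>).

  The area in the definition of the action is that of the topological inside of the level curve.
  It coincides with the open sublevel set because the energy grows along rays (\<open>inside_level\<close>).
  Smoothness is obtained by counting derivatives: sums, products, compositions, inverse functions
  and integrals with a parameter have \<open>n\<close> derivatives by induction on \<open>n\<close>.\<close>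

section \<open>Infinitely differentiable functions of a real variable\<close>

text \<open>Quantifying over some derivative \<open>u'\<close> instead of writing \<^term>\<open>deriv u\<close> keeps the
  closure properties below free of congruence arguments: the induction step exhibits the derivative
  given by the usual rule.\<close>
primrec times_differentiable_on :: "nat \<Rightarrow> real set \<Rightarrow> (real \<Rightarrow> real) \<Rightarrow> bool" where
  "times_differentiable_on 0 U u \<longleftrightarrow> True"
| "times_differentiable_on (Suc n) U u \<longleftrightarrow>
     (\<exists>u'. (\<forall>x\<in>U. (u has_field_derivative u' x) (at x)) \<and> times_differentiable_on n U u')"

lemma times_differentiable_on_SucI:
  assumes "\<And>x. x \<in> U \<Longrightarrow> (u has_field_derivative u' x) (at x)" "times_differentiable_on n U u'"
  shows "times_differentiable_on (Suc n) U u"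
  using assms by auto

lemma times_differentiable_on_SucE:
  assumes "times_differentiable_on (Suc n) U u"
  obtains u' where "\<And>x. x \<in> U \<Longrightarrow> (u has_field_derivative u' x) (at x)"
    "times_differentiable_on n U u'"
  using assms by auto

lemma times_differentiable_on_SucD:
  "times_differentiable_on (Suc n) U u \<Longrightarrow> times_differentiable_on n U u"
proof (induction n arbitrary: u)
  case (Suc n)
  from Suc.prems show ?case
    by (rule times_differentiable_on_SucE) (blast intro: times_differentiable_on_SucI Suc.IH)
qed simp

lemma times_differentiable_on_cong:
  assumes "open U"
  shows "times_differentiable_on n U u \<Longrightarrow> (\<And>x. x \<in> U \<Longrightarrow> v x = u x) \<Longrightarrow> times_differentiable_on n U v"
proof (cases n)
  case (Suc k)
  assume "times_differentiable_on n U u" and eq: "\<And>x. x \<in> U \<Longrightarrow> v x = u x"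
  then obtain u' where u': "\<And>x. x \<in> U \<Longrightarrow> (u has_field_derivative u' x) (at x)"
    "times_differentiable_on k U u'"
    using Suc by auto
  have "(v has_field_derivative u' x) (at x)" if "x \<in> U" for x
    using has_field_derivative_transform_within_open[OF u'(1)[OF that] assms that] eq by auto
  then show ?thesis
    using u'(2) Suc by auto
qed simp

lemma times_differentiable_on_const: "times_differentiable_on n U (\<lambda>x. c)"
proof (induction n arbitrary: c)
  case (Suc n)
  show ?case
    by (rule times_differentiable_on_SucI[where u' = "\<lambda>x. 0"]) (simp_all add: Suc)
qed simp

lemma times_differentiable_on_ident: "times_differentiable_on n U (\<lambda>x. x)"
proof (cases n)
  case (Suc k)
  show ?thesis
    unfolding Suc by (rule times_differentiable_on_SucI[where u' = "\<lambda>x. 1"]) (simp_all add: times_differentiable_on_const)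
qed simp

lemma times_differentiable_on_add:
  "times_differentiable_on n U u \<Longrightarrow> times_differentiable_on n U v \<Longrightarrow>
    times_differentiable_on n U (\<lambda>x. u x + v x)"
proof (induction n arbitrary: u v)
  case (Suc n)
  obtain u' where u':
    "\<And>x. x \<in> U \<Longrightarrow> (u has_field_derivative u' x) (at x)" "times_differentiable_on n U u'"
    using times_differentiable_on_SucE[OF Suc.prems(1)] by blast
  obtain v' where v':
    "\<And>x. x \<in> U \<Longrightarrow> (v has_field_derivative v' x) (at x)" "times_differentiable_on n U v'"
    using times_differentiable_on_SucE[OF Suc.prems(2)] by blast
  show ?case
    by (rule times_differentiable_on_SucI[where u' = "\<lambda>x. u' x + v' x"])
      (auto intro!: DERIV_add u' v' Suc.IH)
qed simp

lemma times_differentiable_on_mult: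
  "times_differentiable_on n U u \<Longrightarrow> times_differentiable_on n U v \<Longrightarrow>
    times_differentiable_on n U (\<lambda>x. u x * v x)"
proof (induction n arbitrary: u v)
  case (Suc n)
  obtain u' where u':
    "\<And>x. x \<in> U \<Longrightarrow> (u has_field_derivative u' x) (at x)" "times_differentiable_on n U u'"
    using times_differentiable_on_SucE[OF Suc.prems(1)] by blast
  obtain v' where v':
    "\<And>x. x \<in> U \<Longrightarrow> (v has_field_derivative v' x) (at x)" "times_differentiable_on n U v'"
    using times_differentiable_on_SucE[OF Suc.prems(2)] by blast
  show ?case
  proof (rule times_differentiable_on_SucI)
    show "((\<lambda>x. u x * v x) has_field_derivative u' x * v x + v' x * u x) (at x)" if "x \<in> U" for x
      using DERIV_mult[OF u'(1) v'(1)] that by blast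
    show "times_differentiable_on n U (\<lambda>x. u' x * v x + v' x * u x)"
      using Suc.prems[THEN times_differentiable_on_SucD] u'(2) v'(2)
      by (intro times_differentiable_on_add Suc.IH)
  qed
qed simp

lemma times_differentiable_on_diff:
  assumes "times_differentiable_on n U u" "times_differentiable_on n U v"
  shows "times_differentiable_on n U (\<lambda>x. u x - v x)"
  using times_differentiable_on_add[OF assms(1)
      times_differentiable_on_mult[OF times_differentiable_on_const[of n U "-1"] assms(2)]]
  by simp

lemma times_differentiable_on_power:
  "times_differentiable_on n U u \<Longrightarrow> times_differentiable_on n U (\<lambda>x. u x ^ k)"
  by (induction k) (simp_all add: times_differentiable_on_const times_differentiable_on_mult)

lemma times_differentiable_on_compose:
  "times_differentiable_on n V u \<Longrightarrow> times_differentiable_on n U v \<Longrightarrow> v ` U \<subseteq> V \<Longrightarrow>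
    times_differentiable_on n U (\<lambda>x. u (v x))"
proof (induction n arbitrary: u)
  case (Suc n)
  obtain u' where u':
    "\<And>x. x \<in> V \<Longrightarrow> (u has_field_derivative u' x) (at x)" "times_differentiable_on n V u'"
    using times_differentiable_on_SucE[OF Suc.prems(1)] by blast
  obtain v' where v':
    "\<And>x. x \<in> U \<Longrightarrow> (v has_field_derivative v' x) (at x)" "times_differentiable_on n U v'"
    using times_differentiable_on_SucE[OF Suc.prems(2)] by blast
  show ?case
  proof (rule times_differentiable_on_SucI)
    show "((\<lambda>x. u (v x)) has_field_derivative u' (v x) * v' x) (at x)" if "x \<in> U" for x
      using DERIV_chain2[OF u'(1) v'(1)] that Suc.prems(3) by blast
    show "times_differentiable_on n U (\<lambda>x. u' (v x) * v' x)"
      using Suc.IH[OF u'(2) Suc.prems(2)[THEN times_differentiable_on_SucD] Suc.prems(3)] v'(2)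
      by (rule times_differentiable_on_mult)
  qed
qed simp

lemma times_differentiable_on_reciprocal: "times_differentiable_on n (- {0}) (inverse :: real \<Rightarrow> real)"
proof (induction n)
  case (Suc n)
  have "times_differentiable_on n (- {0}) (\<lambda>x::real. (-1) * (inverse x * inverse x))"
    using Suc by (intro times_differentiable_on_mult times_differentiable_on_const) auto
  moreover have "(inverse has_field_derivative (-1) * (inverse x * inverse x)) (at x)"
    if "x \<in> - {0}" for x :: real
    using DERIV_inverse[of x] that by (simp add: power2_eq_square)
  ultimately show ?case
    by (intro times_differentiable_on_SucI)
qed simp

lemma times_differentiable_on_inverse:
  assumes "times_differentiable_on n U u" "\<And>x. x \<in> U \<Longrightarrow> u x \<noteq> 0"
  shows "times_differentiable_on n U (\<lambda>x. inverse (u x))"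
proof (rule times_differentiable_on_compose[OF times_differentiable_on_reciprocal assms(1)])
  show "u ` U \<subseteq> - {0}"
    using assms(2) by auto
qed

lemmas times_differentiable_intros =
  times_differentiable_on_const times_differentiable_on_ident times_differentiable_on_add
  times_differentiable_on_diff times_differentiable_on_mult times_differentiable_on_power
  times_differentiable_on_inverse

lemma times_differentiable_on_sqrt:
  assumes "times_differentiable_on n U u" "\<And>x. x \<in> U \<Longrightarrow> 0 < u x"
  shows "times_differentiable_on n U (\<lambda>x. sqrt (u x))"
proof -
  have "times_differentiable_on n {0<..} sqrt"
  proof (induction n)
    case (Suc n)
    have "times_differentiable_on n {0<..} (\<lambda>x. inverse (sqrt x) * (1 / 2))"
      using Suc by (intro times_differentiable_on_mult times_differentiable_on_const
          times_differentiable_on_inverse) auto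
    moreover have "(sqrt has_field_derivative inverse (sqrt x) * (1 / 2)) (at x)" if "x \<in> {0<..}" for x
      using DERIV_real_sqrt[of x] that by simp
    ultimately show ?case
      by (intro times_differentiable_on_SucI)
  qed simp
  moreover have "u ` U \<subseteq> {0<..}"
    using assms(2) by auto
  ultimately show ?thesis
    using assms(1) times_differentiable_on_compose[of n "{0<..}" sqrt U u] by blast
qed

lemma all_times_differentiable_on_deriv:
  assumes "\<And>n. times_differentiable_on n UNIV u" and "\<And>x. (u has_field_derivative u' x) (at x)"
  shows "times_differentiable_on n UNIV u'"
proof -
  obtain u'' where u'': "\<And>x. (u has_field_derivative u'' x) (at x)" "times_differentiable_on n UNIV u''"
    using assms(1)[of "Suc n"] by auto
  have "u'' = u'"
    using DERIV_unique[OF u''(1) assms(2)] by auto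
  then show ?thesis
    using u''(2) by simp
qed

lemma all_times_differentiable_on_obtain_deriv:
  assumes "\<And>n. times_differentiable_on n UNIV u"
  obtains u' where "\<And>x. (u has_field_derivative u' x) (at x)"
    and "\<And>n. times_differentiable_on n UNIV u'"
proof -
  obtain u' where u': "\<And>x. (u has_field_derivative u' x) (at x)"
    using assms[of "Suc 0"] by auto
  then show thesis
    using all_times_differentiable_on_deriv[OF assms u'] by (rule that)
qed

lemma all_times_differentiable_on_continuous:
  assumes "\<And>n. times_differentiable_on n UNIV u"
  shows "continuous_on S u"
proof -
  obtain u' where "\<And>x. (u has_field_derivative u' x) (at x)"
    using assms[of "Suc 0"] by auto
  then show ?thesis
    by (rule DERIV_continuous_on[OF has_field_derivative_at_within])
qed

text \<open>The passage from derivatives chosen at will to the iterates of \<^const>\<open>deriv\<close>; openness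
  of \<open>U\<close> makes the two agree near every point of \<open>U\<close>, not only at the point itself.\<close>
lemma all_times_differentiable_on_imp_smooth:
  assumes "\<And>n. times_differentiable_on n U u" and "open U"
  shows "\<forall>n. \<forall>x\<in>U. (deriv ^^ n) u differentiable at x"
proof -
  have "times_differentiable_on (Suc n) U u \<Longrightarrow> \<forall>x\<in>U. (deriv ^^ n) u differentiable at x" for n
  proof (induction n arbitrary: u)
    case 0
    then show ?case
      by (auto simp: real_differentiable_def)
  next
    case (Suc n)
    then obtain u' where u': "\<And>x. x \<in> U \<Longrightarrow> (u has_field_derivative u' x) (at x)"
      "times_differentiable_on (Suc n) U u'"
      by (metis times_differentiable_on.simps(2))
    have "times_differentiable_on (Suc n) U (deriv u)"
      using u' by (intro times_differentiable_on_cong[OF \<open>open U\<close> u'(2)]) (auto intro: DERIV_imp_deriv)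
    then show ?case
      using Suc.IH by (simp only: funpow_Suc_right comp_def)
  qed
  then show ?thesis
    using assms(1) by blast
qed

text \<open>The inverse function satisfies \<open>k' = 1 / (h' \<circ> k)\<close>, so each degree of differentiability of
  \<open>k\<close> yields the next one.\<close>
lemma times_differentiable_on_inv:
  assumes "\<And>n. times_differentiable_on n UNIV h"
    and h': "\<And>x. (h has_field_derivative h' x) (at x)" and pos: "\<And>x. 0 < h' x"
  shows "strict_mono h"
    and "open (range h)"
    and "\<And>x. (inv h has_field_derivative inverse (h' x)) (at (h x))"
    and "times_differentiable_on n (range h) (inv h)"
proof -
  show mono: "strict_mono h"
    using DERIV_pos_imp_increasing h' pos by (metis strict_mono_def)
  then have inj: "inj h"
    by (rule strict_mono_imp_inj_on)
  have cont: "continuous_on UNIV h"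
    using h' by (rule DERIV_continuous_on)
  show "open (range h)"
    using injective_eq_1d_open_map_UNIV[of UNIV h] cont inj by (auto simp: is_interval_univ)
  show inv': "(inv h has_field_derivative inverse (h' x)) (at (h x))" for x
    using has_derivative_inverse_strong[of UNIV x h "inv h" "(*) (h' x)" "(*) (inverse (h' x))"]
      cont h'[of x] pos[of x] inj by (auto simp: has_field_derivative_def fun_eq_iff)
  show "times_differentiable_on n (range h) (inv h)"
  proof (induction n)
    case (Suc n)
    have "times_differentiable_on n (range h) (\<lambda>x. inverse (h' (inv h x)))"
      using pos by (intro times_differentiable_on_inverse times_differentiable_on_compose[OF
            all_times_differentiable_on_deriv[OF assms(1) h'] Suc]) (auto simp: less_imp_neq[symmetric])
    moreover have "(inv h has_field_derivative inverse (h' (inv h y))) (at y)" if "y \<in> range h" for y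
      using that inv' inj by auto
    ultimately show ?case
      by (intro times_differentiable_on_SucI)
  qed simp
qed

lemma parametric_integral_deriv:
  fixes u u' c s :: "real \<Rightarrow> real"
  assumes u': "\<And>x. (u has_field_derivative u' x) (at x)" and "continuous_on UNIV u'"
    and c: "continuous_on {\<alpha>..\<beta>} c" and s: "continuous_on {\<alpha>..\<beta>} s"
  shows "((\<lambda>x. integral {\<alpha>..\<beta>} (\<lambda>t. c t * u (x * s t))) has_field_derivative
      integral {\<alpha>..\<beta>} (\<lambda>t. c t * s t * u' (x * s t))) (at x)"
proof -
  have u: "continuous_on UNIV u"
    using u' by (rule DERIV_continuous_on)
  have "((\<lambda>x. integral (cbox \<alpha> \<beta>) (\<lambda>t. c t * u (x * s t))) has_field_derivative
      integral (cbox \<alpha> \<beta>) (\<lambda>t. c t * s t * u' (x * s t))) (at x within UNIV)"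
  proof (rule leibniz_rule_field_derivative)
    show "((\<lambda>x. c t * u (x * s t)) has_field_derivative c t * s t * u' (x * s t)) (at x within UNIV)"
      for x t
      by (auto intro!: derivative_eq_intros DERIV_chain2[OF u'])
    show "(\<lambda>t. c t * u (x * s t)) integrable_on cbox \<alpha> \<beta>" for x
      by (intro integrable_continuous continuous_on_mult continuous_on_compose2[OF u])
        (use c s in \<open>auto intro!: continuous_intros\<close>)
    show "continuous_on (UNIV \<times> cbox \<alpha> \<beta>) (\<lambda>(x, t). c t * s t * u' (x * s t))"
      unfolding case_prod_beta
      by (intro continuous_intros continuous_on_compose2[OF assms(2)] continuous_on_compose2[OF c]
          continuous_on_compose2[OF s]) auto
  qed auto
  then show ?thesis
    by simp
qed

text \<open>Differentiation under the integral sign replaces \<open>u\<close> by \<open>u'\<close> and the weight \<open>c\<close> by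
  \<open>c s\<close>. The integral keeps its shape, which is why the induction runs over arbitrary weights.\<close>
lemma times_differentiable_on_parametric_integral:
  fixes u c s :: "real \<Rightarrow> real"
  assumes "\<And>n. times_differentiable_on n UNIV u"
    and "continuous_on {\<alpha>..\<beta>} c" "continuous_on {\<alpha>..\<beta>} s"
  shows "times_differentiable_on n UNIV (\<lambda>x. integral {\<alpha>..\<beta>} (\<lambda>t. c t * u (x * s t)))"
  using assms
proof (induction n arbitrary: u c)
  case (Suc n)
  obtain u' where u': "\<And>x. (u has_field_derivative u' x) (at x)"
    and u'_diff: "\<And>n. times_differentiable_on n UNIV u'"
    using all_times_differentiable_on_obtain_deriv[OF Suc.prems(1)] by blast
  have cont: "continuous_on UNIV u'"
    by (rule all_times_differentiable_on_continuous[OF u'_diff])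
  have "times_differentiable_on n UNIV (\<lambda>x. integral {\<alpha>..\<beta>} (\<lambda>t. c t * s t * u' (x * s t)))"
    using continuous_on_mult[OF Suc.prems(2,3)] Suc.prems(3) by (rule Suc.IH[OF u'_diff])
  moreover have "((\<lambda>x. integral {\<alpha>..\<beta>} (\<lambda>t. c t * u (x * s t))) has_field_derivative
      integral {\<alpha>..\<beta>} (\<lambda>t. c t * s t * u' (x * s t))) (at x)" for x
    using u' cont Suc.prems(2,3) by (rule parametric_integral_deriv)
  ultimately show ?case
    by (intro times_differentiable_on_SucI)
qed simp

section \<open>The one-dimensional well and its normalizing coordinate\<close>

locale hill_parameters =
  fixes f g :: real
  assumes f_pos: "0 < f" and g_neg: "g < 0"
begin

text \<open>The potential energy \<open>f z\<^sup>2 - g z\<^sup>6\<close> of one degree of freedom is \<open>cubic (z\<^sup>2)\<close>. Since \<open>cubic\<close>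
  is an increasing diffeomorphism of the whole line, all functions built from its inverse are
  smooth on the whole line, in particular across the energy \<open>0\<close>.\<close>
definition cubic :: "real \<Rightarrow> real" where
  "cubic y = f * y - g * y ^ 3"

definition cubic_inv :: "real \<Rightarrow> real" where
  "cubic_inv = inv cubic"

text \<open>The quotient \<open>u / z\<close> at \<open>x = u\<^sup>2 = f z\<^sup>2 - g z\<^sup>6\<close>, where \<open>z\<^sup>2\<close> is \<open>cubic_inv x\<close>.\<close>
definition radius :: "real \<Rightarrow> real" where
  "radius x = sqrt (f - g * (cubic_inv x)\<^sup>2)"

text \<open>As a function of \<open>x = u\<^sup>2\<close>, this is the derivative of \<open>turning_point\<close> at \<open>u\<close>. Expressing it
  through \<open>x\<close> is what makes the action smooth at energy \<open>0\<close>, where \<open>u = \<surd>x\<close> is not.\<close>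
definition stretch :: "real \<Rightarrow> real" where
  "stretch x = radius x * inverse (f - 3 * g * (cubic_inv x)\<^sup>2)"

text \<open>The coordinate in which the well becomes harmonic: \<open>z = turning_point u\<close> is the solution of
  \<open>f z\<^sup>2 - g z\<^sup>6 = u\<^sup>2\<close> with the sign of \<open>u\<close>. At \<open>u = \<surd>a\<close> it is the turning point of the motion
  with energy \<open>a\<close>.\<close>
definition turning_point :: "real \<Rightarrow> real" where
  "turning_point u = u / radius (u\<^sup>2)"

text \<open>The area of the sublevel set of energy \<open>a\<close> after the substitution
  \<open>z = turning_point (\<surd>a sin t)\<close>. The formula makes sense for negative \<open>a\<close> too, and so provides
  the smooth extension beyond energy \<open>0\<close>.\<close>
definition area :: "real \<Rightarrow> real" where
  "area a = 4 * sqrt 2 * (a * integral {-(pi/2)..pi/2} (\<lambda>t. (cos t)\<^sup>2 * stretch (a * (sin t)\<^sup>2)))"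

text \<open>The derivative of \<open>area\<close>, that is, the period of the motion with energy \<open>a\<close>.\<close>
definition area_rate :: "real \<Rightarrow> real" where
  "area_rate a = 2 * sqrt 2 * integral {-(pi/2)..pi/2} (\<lambda>t. stretch (a * (sin t)\<^sup>2))"

lemma f_minus_g_square_pos: "0 < f - g * y\<^sup>2" "0 < f - 3 * g * y\<^sup>2"
proof -
  have "g * y\<^sup>2 \<le> 0"
    using g_neg by (simp add: mult_le_0_iff)
  then show "0 < f - g * y\<^sup>2" "0 < f - 3 * g * y\<^sup>2"
    using f_pos by linarith+
qed

lemma g_square_less [simp]: "g * y\<^sup>2 < f" "3 * g * y\<^sup>2 < f"
  using f_minus_g_square_pos[of y] by simp_all

lemma cubic_deriv: "(cubic has_field_derivative f - 3 * g * y\<^sup>2) (at y)"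
  unfolding cubic_def by (auto intro!: derivative_eq_intros)

lemma cubic_smooth: "times_differentiable_on n UNIV cubic"
  unfolding cubic_def by (intro times_differentiable_intros)

lemmas cubic_inverse_facts = times_differentiable_on_inv[OF cubic_smooth cubic_deriv f_minus_g_square_pos(2)]

lemma range_cubic: "range cubic = UNIV"
proof -
  have "\<exists>y. cubic y = x" for x
  proof -
    \<comment> \<open>The linear term of the cubic alone already reaches \<open>x\<close> at \<open>\<plusminus> r\<close>.\<close>
    define r where "r = \<bar>x\<bar> / f"
    have r: "0 \<le> r" "f * r = \<bar>x\<bar>"
      using f_pos by (simp_all add: r_def)
    have "g * r ^ 3 \<le> 0"
      using r g_neg by (simp add: mult_le_0_iff)
    then have "cubic (- r) \<le> x" "x \<le> cubic r"
      using r by (simp_all add: cubic_def)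
    moreover have "continuous_on {- r..r} cubic"
      by (rule DERIV_continuous_on[OF has_field_derivative_at_within[OF cubic_deriv]])
    ultimately show ?thesis
      using IVT'[of cubic "- r" x r] r by auto
  qed
  then show ?thesis
    by (metis surjI surj_def)
qed

lemma cubic_cubic_inv: "cubic (cubic_inv x) = x"
  unfolding cubic_inv_def by (rule surj_f_inv_f[OF range_cubic])

lemma cubic_less_iff: "cubic x < cubic y \<longleftrightarrow> x < y"
  by (rule strict_mono_less[OF cubic_inverse_facts(1)])

lemma cubic_0: "cubic 0 = 0"
  by (simp add: cubic_def)

lemma cubic_inv_le_iff: "cubic_inv x \<le> y \<longleftrightarrow> x \<le> cubic y"
  using cubic_less_iff[of y "cubic_inv x"] by (auto simp: cubic_cubic_inv not_less[symmetric])

lemma cubic_inv_mono: "x \<le> y \<Longrightarrow> cubic_inv x \<le> cubic_inv y"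
  by (simp add: cubic_inv_le_iff cubic_cubic_inv)

lemma cubic_inv_0: "cubic_inv 0 = 0"
  using inv_f_f[OF strict_mono_imp_inj_on[OF cubic_inverse_facts(1)], of 0]
  by (simp add: cubic_0 cubic_inv_def)

lemma cubic_inv_nonneg: "0 \<le> x \<Longrightarrow> 0 \<le> cubic_inv x"
  using cubic_inv_mono[of 0 x] by (simp add: cubic_inv_0)

lemma cubic_inv_smooth: "times_differentiable_on n UNIV cubic_inv"
  using cubic_inverse_facts(4) by (simp add: range_cubic cubic_inv_def)

lemma cubic_inv_deriv: "(cubic_inv has_field_derivative inverse (f - 3 * g * (cubic_inv x)\<^sup>2)) (at x)"
  using cubic_inverse_facts(3)[of "cubic_inv x"] by (simp add: cubic_cubic_inv) (simp add: cubic_inv_def)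

lemma radius_pos: "0 < radius x"
  by (simp add: radius_def f_minus_g_square_pos)

lemma radius_square: "(radius x)\<^sup>2 = f - g * (cubic_inv x)\<^sup>2"
  by (simp add: radius_def f_minus_g_square_pos less_imp_le)

lemma cubic_inv_radius: "cubic_inv x * (radius x)\<^sup>2 = x"
  using cubic_cubic_inv[of x]
  unfolding radius_square by (simp add: cubic_def algebra_simps power2_eq_square power3_eq_cube)

lemma stretch_pos: "0 < stretch x"
  unfolding stretch_def by (intro mult_pos_pos radius_pos positive_imp_inverse_positive f_minus_g_square_pos)

lemma stretch_smooth: "times_differentiable_on n UNIV stretch"
  unfolding stretch_def radius_def
  by (intro times_differentiable_intros times_differentiable_on_sqrt cubic_inv_smooth)
    (simp_all add: less_imp_neq[OF g_square_less(2), symmetric])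

text \<open>With \<open>p\<close> the radius, the stretch is \<open>p / (3 p\<^sup>2 - 2 f) = 1 / (3 p - 2 f / p)\<close>, which decreases in
  \<open>p\<close>; and for \<open>x \<ge> 0\<close> the radius increases because \<open>g < 0\<close>. Through this step the
  sign of \<open>g\<close> makes the period fall with the energy.\<close>
lemma stretch_antimono:
  assumes "0 \<le> x" "x \<le> y"
  shows "stretch y \<le> stretch x"
proof -
  define p q where "p = radius x" and "q = radius y"
  have pos: "0 < p" "0 < q"
    by (simp_all add: p_def q_def radius_pos)
  have "(cubic_inv x)\<^sup>2 \<le> (cubic_inv y)\<^sup>2"
    using assms by (intro power_mono cubic_inv_mono cubic_inv_nonneg)
  then have "p \<le> q"
    using g_neg by (simp add: p_def q_def radius_def)
  have den: "f - 3 * g * (cubic_inv x)\<^sup>2 = 3 * p\<^sup>2 - 2 * f" "f - 3 * g * (cubic_inv y)\<^sup>2 = 3 * q\<^sup>2 - 2 * f"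
    by (simp_all add: p_def q_def radius_square)
  have "0 < 3 * p\<^sup>2 - 2 * f" "0 < 3 * q\<^sup>2 - 2 * f"
    using f_minus_g_square_pos(2)[of "cubic_inv x"] f_minus_g_square_pos(2)[of "cubic_inv y"] den by simp_all
  moreover have "0 \<le> (3 * p * q + 2 * f) * (q - p)"
    using pos \<open>p \<le> q\<close> f_pos by simp
  then have "q * (3 * p\<^sup>2 - 2 * f) \<le> p * (3 * q\<^sup>2 - 2 * f)"
    by (simp add: algebra_simps power2_eq_square)
  ultimately show ?thesis
    by (simp add: stretch_def den flip: p_def q_def) (simp add: field_simps)
qed

lemma stretch_continuous: "continuous_on S stretch"
  by (rule all_times_differentiable_on_continuous[OF stretch_smooth])

lemma turning_point_square: "(turning_point u)\<^sup>2 = cubic_inv (u\<^sup>2)"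
proof -
  have "(radius (u\<^sup>2))\<^sup>2 \<noteq> 0"
    using radius_pos[of "u\<^sup>2"] by simp
  then have "u\<^sup>2 / (radius (u\<^sup>2))\<^sup>2 = cubic_inv (u\<^sup>2)"
    by (subst nonzero_divide_eq_eq) (simp_all only: cubic_inv_radius not_False_eq_True)
  then show ?thesis
    by (simp only: turning_point_def power_divide)
qed

lemma turning_point_deriv: "(turning_point has_field_derivative stretch (u\<^sup>2)) (at u)"
proof -
  define r S D where "r = cubic_inv (u\<^sup>2)" and "S = radius (u\<^sup>2)" and "D = f - 3 * g * r\<^sup>2"
  have pos: "0 < S" "0 < D"
    by (simp_all add: S_def D_def radius_pos f_minus_g_square_pos)
  have sq: "S\<^sup>2 = f - g * r\<^sup>2" "u\<^sup>2 = r * S\<^sup>2"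
    using cubic_inv_radius[of "u\<^sup>2"] by (simp_all add: S_def r_def radius_square)
  have root': "((\<lambda>u. cubic_inv (u\<^sup>2)) has_field_derivative inverse D * (2 * u)) (at u)"
    unfolding D_def r_def by (rule DERIV_chain2[OF cubic_inv_deriv]) (auto intro!: derivative_eq_intros)
  have radius': "((\<lambda>u. radius (u\<^sup>2)) has_field_derivative
      inverse S / 2 * (- (g * (2 * r * (inverse D * (2 * u)))))) (at u)"
    unfolding radius_def S_def
    by (rule DERIV_chain2[OF DERIV_real_sqrt])
      (auto intro!: derivative_eq_intros root' simp: f_minus_g_square_pos r_def)
  have "((\<lambda>u. u / radius (u\<^sup>2)) has_field_derivative
      (1 * S - u * (inverse S / 2 * (- (g * (2 * r * (inverse D * (2 * u))))))) / (S * S)) (at u)"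
    unfolding S_def by (rule DERIV_divide[OF DERIV_ident radius'[unfolded S_def]])
      (use radius_pos[of "u\<^sup>2"] in simp)
  moreover have "(1 * S - u * (inverse S / 2 * (- (g * (2 * r * (inverse D * (2 * u))))))) / (S * S)
      = (S + 2 * g * r * u\<^sup>2 / (S * D)) / S\<^sup>2"
    using pos by (simp add: field_simps power2_eq_square)
  moreover have "\<dots> = (D + 2 * g * r\<^sup>2) / (S * D)"
    unfolding sq(2) using pos by (simp add: field_simps power2_eq_square)
  moreover have "\<dots> = S\<^sup>2 / (S * D)"
    by (simp add: sq D_def)
  moreover have "\<dots> = stretch (u\<^sup>2)"
    using pos by (simp add: stretch_def D_def S_def r_def power2_eq_square divide_inverse)
  ultimately show ?thesis
    unfolding turning_point_def by simp
qed

section \<open>The area function is increasing and concave\<close>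

text \<open>Differentiating under the integral leaves the weights \<open>cos\<^sup>2\<close> and \<open>cos\<^sup>2 sin\<^sup>2\<close>. The function
  \<open>sin t cos t stretch (a sin\<^sup>2 t) / 2\<close> vanishes at both ends, so its derivative integrates to \<open>0\<close>;
  subtracting it removes the derivative of \<open>stretch\<close>, and \<open>cos\<^sup>2 - (cos\<^sup>2 - sin\<^sup>2) / 2 = 1/2\<close> remains as the weight.\<close>
lemma area_deriv: "(area has_field_derivative area_rate a) (at a)"
proof -
  obtain s' where s': "\<And>x. (stretch has_field_derivative s' x) (at x)"
    and "\<And>n. times_differentiable_on n UNIV s'"
    using all_times_differentiable_on_obtain_deriv[OF stretch_smooth] by blast
  then have cont: "continuous_on S s'" for S
    by (intro all_times_differentiable_on_continuous)
  note cont2 = continuous_on_compose2[OF cont[of UNIV]] continuous_on_compose2[OF stretch_continuous[of UNIV]]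
  let ?T = "{-(pi/2)..pi/2}"
  define J J' M where "J = integral ?T (\<lambda>t. (cos t)\<^sup>2 * stretch (a * (sin t)\<^sup>2))"
    and "J' = integral ?T (\<lambda>t. (cos t)\<^sup>2 * (sin t)\<^sup>2 * s' (a * (sin t)\<^sup>2))"
    and "M = integral ?T (\<lambda>t. stretch (a * (sin t)\<^sup>2))"
  have "((\<lambda>a. integral ?T (\<lambda>t. (cos t)\<^sup>2 * stretch (a * (sin t)\<^sup>2))) has_field_derivative J') (at a)"
    unfolding J'_def by (intro parametric_integral_deriv s' cont continuous_intros)
  then have "(area has_field_derivative 4 * sqrt 2 * (1 * J + J' * a)) (at a)"
    unfolding area_def[abs_def] J_def by (intro DERIV_cmult DERIV_mult DERIV_ident)
  moreover have "J + J' * a = M / 2"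
  proof -
    \<comment> \<open>A primitive that trades the derivative of \<open>stretch\<close> for \<open>stretch\<close> itself.\<close>
    define W where "W = (\<lambda>t. sin t * cos t * stretch (a * (sin t)\<^sup>2) / 2)"
    define W' where "W' = (\<lambda>t. ((cos t)\<^sup>2 - (sin t)\<^sup>2) * stretch (a * (sin t)\<^sup>2) / 2
        + a * ((cos t)\<^sup>2 * (sin t)\<^sup>2 * s' (a * (sin t)\<^sup>2)))"
    have W: "(W has_field_derivative W' t) (at t within ?T)" for t
    proof -
      have "((\<lambda>t. stretch (a * (sin t)\<^sup>2)) has_field_derivative
          s' (a * (sin t)\<^sup>2) * (a * (2 * sin t * cos t))) (at t within ?T)"
        by (rule DERIV_chain2[OF s']) (auto intro!: derivative_eq_intros)
      then show ?thesis
        unfolding W_def W'_def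
        by (auto intro!: derivative_eq_intros simp: field_simps power2_eq_square)
    qed
    have "(W' has_integral W (pi/2) - W (-(pi/2))) ?T"
      using W by (intro fundamental_theorem_of_calculus)
        (auto simp flip: has_real_derivative_iff_has_vector_derivative)
    then have W'_int: "(W' has_integral 0) ?T"
      by (simp add: W_def)
    have J_int: "((\<lambda>t. (cos t)\<^sup>2 * stretch (a * (sin t)\<^sup>2)) has_integral J) ?T"
      unfolding J_def by (intro integrable_integral integrable_continuous_real continuous_intros cont2) auto
    have J'_int: "((\<lambda>t. (cos t)\<^sup>2 * (sin t)\<^sup>2 * s' (a * (sin t)\<^sup>2)) has_integral J') ?T"
      unfolding J'_def by (intro integrable_integral integrable_continuous_real continuous_intros cont2) auto
    have M_int: "((\<lambda>t. stretch (a * (sin t)\<^sup>2)) has_integral M) ?T"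
      unfolding M_def by (intro integrable_integral integrable_continuous_real continuous_intros cont2) auto
    have "((\<lambda>t. W' t + stretch (a * (sin t)\<^sup>2) * (1 / 2)) has_integral 0 + M * (1 / 2)) ?T"
      by (intro has_integral_add W'_int has_integral_mult_left M_int)
    moreover have "W' t + stretch (a * (sin t)\<^sup>2) * (1 / 2) =
        (cos t)\<^sup>2 * stretch (a * (sin t)\<^sup>2) + (cos t)\<^sup>2 * (sin t)\<^sup>2 * s' (a * (sin t)\<^sup>2) * a" for t
    proof -
      have "stretch (a * (sin t)\<^sup>2) = ((cos t)\<^sup>2 + (sin t)\<^sup>2) * stretch (a * (sin t)\<^sup>2)"
        by (simp only: sin_cos_squared_add2 mult_1)
      then have "stretch (a * (sin t)\<^sup>2)
          = (cos t)\<^sup>2 * stretch (a * (sin t)\<^sup>2) + (sin t)\<^sup>2 * stretch (a * (sin t)\<^sup>2)"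
        by (simp only: distrib_right)
      then show ?thesis
        unfolding W'_def by (simp add: field_simps)
    qed
    moreover have "((\<lambda>t. (cos t)\<^sup>2 * stretch (a * (sin t)\<^sup>2)
        + (cos t)\<^sup>2 * (sin t)\<^sup>2 * s' (a * (sin t)\<^sup>2) * a) has_integral J + J' * a) ?T"
      by (intro has_integral_add has_integral_mult_left J_int J'_int)
    ultimately have "J + J' * a = 0 + M * (1 / 2)"
      by (simp only: has_integral_unique)
    then show ?thesis
      by simp
  qed
  then have "4 * sqrt 2 * (1 * J + J' * a) = area_rate a"
    by (simp add: area_rate_def flip: M_def)
  ultimately show ?thesis
    by (simp only:)
qed

lemma area_smooth: "times_differentiable_on n UNIV area"
  unfolding area_def[abs_def]
  by (intro times_differentiable_on_mult times_differentiable_on_const times_differentiable_on_ident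
      times_differentiable_on_parametric_integral stretch_smooth continuous_intros)

lemma area_rate_integrable: "(\<lambda>t. stretch (a * (sin t)\<^sup>2)) integrable_on {-(pi/2)..pi/2}"
  by (intro integrable_continuous_real continuous_intros
      continuous_on_compose2[OF stretch_continuous[of UNIV]]) auto

lemma area_rate_pos: "0 < area_rate a"
proof -
  let ?M = "integral {-(pi/2)..pi/2} (\<lambda>t. stretch (a * (sin t)\<^sup>2))"
  have "?M = 0 \<longleftrightarrow> (\<forall>t\<in>{-(pi/2)..pi/2}. stretch (a * (sin t)\<^sup>2) = 0)"
    using stretch_pos by (intro integral_eq_0_iff continuous_intros
        continuous_on_compose2[OF stretch_continuous[of UNIV]]) (auto simp: less_imp_le)
  then have "?M \<noteq> 0"
    using stretch_pos[of "a * (sin 0)\<^sup>2"] pi_gt_zero by (auto intro!: bexI[of _ 0])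
  moreover have "0 \<le> ?M"
    using stretch_pos by (intro integral_nonneg area_rate_integrable) (auto simp: less_imp_le)
  ultimately show ?thesis
    by (simp add: area_rate_def)
qed

lemma area_rate_antimono:
  assumes "0 \<le> a" "a \<le> b"
  shows "area_rate b \<le> area_rate a"
proof -
  have "integral {-(pi/2)..pi/2} (\<lambda>t. stretch (b * (sin t)\<^sup>2))
      \<le> integral {-(pi/2)..pi/2} (\<lambda>t. stretch (a * (sin t)\<^sup>2))"
    using assms by (intro integral_le area_rate_integrable stretch_antimono)
      (auto intro: mult_right_mono)
  then show ?thesis
    by (simp add: area_rate_def)
qed

section \<open>The area enclosed by a level curve\<close>

lemma hill_K_part_eq: "hill_K_part f g (z, w) = w\<^sup>2 / 8 + cubic (z\<^sup>2)"
  by (simp add: hill_K_part_def cubic_def flip: power_mult)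

lemma cubic_square_le_iff:
  assumes "0 \<le> a"
  shows "cubic (z\<^sup>2) \<le> a \<longleftrightarrow> \<bar>z\<bar> \<le> turning_point (sqrt a)"
proof -
  have "0 \<le> turning_point (sqrt a)"
    using assms radius_pos[of a] by (simp add: turning_point_def)
  then have "\<bar>z\<bar> \<le> turning_point (sqrt a) \<longleftrightarrow> z\<^sup>2 \<le> cubic_inv a"
    using turning_point_square[of "sqrt a"] assms abs_le_square_iff[of z "turning_point (sqrt a)"]
    by simp
  also have "\<dots> \<longleftrightarrow> cubic (z\<^sup>2) \<le> a"
    using cubic_less_iff[of "cubic_inv a" "z\<^sup>2"] by (auto simp: cubic_cubic_inv not_less[symmetric])
  finally show ?thesis
    by simp
qed

text \<open>The substitution \<open>z = turning_point (\<surd>a sin t)\<close> turns the integrand into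
  \<open>2 \<surd>8 \<surd>a cos t\<close> and the measure \<open>dz\<close> into \<open>stretch (a sin\<^sup>2 t) \<surd>a cos t dt\<close>.\<close>
lemma has_integral_area:
  assumes "0 \<le> a"
  defines "Z \<equiv> turning_point (sqrt a)"
  shows "((\<lambda>z. 2 * sqrt (8 * (a - cubic (z\<^sup>2)))) has_integral area a) {-Z..Z}"
proof -
  let ?F = "\<lambda>z. 2 * sqrt (8 * (a - cubic (z\<^sup>2)))"
  let ?T = "{-(pi/2)..pi/2}"
  define G where "G = (\<lambda>t. turning_point (sqrt a * sin t))"
  define G' where "G' = (\<lambda>t. stretch (a * (sin t)\<^sup>2) * (sqrt a * cos t))"
  have G_square: "cubic ((G t)\<^sup>2) = a * (sin t)\<^sup>2" for t
    using assms by (simp add: G_def turning_point_square cubic_cubic_inv power_mult_distrib)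
  have G_ends: "G (-(pi/2)) = - Z" "G (pi/2) = Z"
    by (simp_all add: G_def Z_def turning_point_def)
  have "G t \<in> {-Z..Z}" for t
  proof -
    have "cubic ((G t)\<^sup>2) \<le> a"
      using assms by (simp add: G_square mult_left_le abs_square_le_1)
    then show ?thesis
      using cubic_square_le_iff[OF assms(1)] unfolding Z_def by auto
  qed
  moreover have "0 \<le> Z"
    using calculation[of 0] by auto
  moreover have cont: "continuous_on {-Z..Z} ?F"
    unfolding cubic_def by (intro continuous_intros)
  moreover have "(G has_field_derivative G' t) (at t within ?T)" for t
  proof -
    have "((\<lambda>t. sqrt a * sin t) has_field_derivative sqrt a * cos t) (at t within ?T)"
      by (auto intro!: derivative_eq_intros)
    from DERIV_chain2[OF turning_point_deriv this] show ?thesis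
      using assms by (simp add: G_def G'_def power_mult_distrib)
  qed
  ultimately have "((\<lambda>t. G' t *\<^sub>R ?F (G t)) has_integral integral {-Z..Z} ?F) ?T"
    using has_integral_substitution[of "-(pi/2)" "pi/2" G "-Z" Z ?F G'] pi_gt_zero
    unfolding G_ends by (simp add: image_subset_iff)
  moreover have "G' t *\<^sub>R ?F (G t) = 4 * sqrt 2 * a * ((cos t)\<^sup>2 * stretch (a * (sin t)\<^sup>2))"
    if "t \<in> ?T" for t
  proof -
    have "0 \<le> cos t"
      using that by (intro cos_ge_zero) auto
    then have "sqrt (8 * (a - cubic ((G t)\<^sup>2))) = 2 * cos t * (sqrt 2 * sqrt a)"
      using assms by (intro real_sqrt_unique)
        (simp_all add: G_square power_mult_distrib cos_squared_eq algebra_simps)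
    then show ?thesis
      using assms by (simp add: G'_def power2_eq_square)
  qed
  ultimately have "((\<lambda>t. 4 * sqrt 2 * a * ((cos t)\<^sup>2 * stretch (a * (sin t)\<^sup>2)))
      has_integral integral {-Z..Z} ?F) ?T"
    by (rule has_integral_eq[rotated])
  from integral_unique[OF this] have "integral {-Z..Z} ?F = area a"
    by (simp only: area_def integral_mult_right mult.assoc)
  moreover have "?F integrable_on {-Z..Z}"
    using cont by (rule integrable_continuous_real)
  ultimately show ?thesis
    using integrable_integral by fastforce
qed

text \<open>By Fubini the sublevel set is sliced over \<open>z\<close>. As \<^const>\<open>sqrt\<close> is an odd function, beyond the turning
  points \<open>r\<close> is negative and \<open>{-r<..<r}\<close> is empty, which is the slice there too.\<close>
lemma emeasure_sublevel:
  assumes "0 \<le> a"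
  shows "emeasure lborel {x. hill_K_part f g x < a} = ennreal (area a)"
proof -
  define Z where "Z = turning_point (sqrt a)"
  define F where "F = (\<lambda>z. 2 * sqrt (8 * (a - cubic (z\<^sup>2))))"
  define F0 where "F0 = (\<lambda>z. if z \<in> {-Z..Z} then F z else 0)"
  have F_nonneg: "0 \<le> F z \<longleftrightarrow> z \<in> {-Z..Z}" for z
    using cubic_square_le_iff[OF assms, of z] unfolding Z_def F_def by auto
  let ?S = "{x. hill_K_part f g x < a}"
  have "open ?S"
    unfolding hill_K_part_def case_prod_beta by (intro open_Collect_less continuous_intros) simp_all
  then have "?S \<in> sets (lborel \<Otimes>\<^sub>M lborel)"
    by (simp only: lborel_prod sets_lborel borel_open)
  then have "emeasure lborel ?S = (\<integral>\<^sup>+ z. emeasure lborel (Pair z -` ?S) \<partial>lborel)"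
    using lborel.emeasure_pair_measure_alt[of ?S lborel] by (simp add: lborel_prod)
  also have "\<dots> = (\<integral>\<^sup>+ z. ennreal (F0 z) \<partial>lborel)"
  proof (rule nn_integral_cong)
    fix z
    define r where "r = sqrt (8 * (a - cubic (z\<^sup>2)))"
    have in_slice: "w \<in> Pair z -` ?S \<longleftrightarrow> \<bar>w\<bar> < r" for w
    proof -
      have "w \<in> Pair z -` ?S \<longleftrightarrow> w\<^sup>2 < 8 * (a - cubic (z\<^sup>2))"
        by (auto simp: hill_K_part_eq)
      then show ?thesis
        using real_sqrt_less_iff[of "w\<^sup>2" "8 * (a - cubic (z\<^sup>2))"] by (simp only: r_def real_sqrt_abs)
    qed
    have "Pair z -` ?S = {-r<..<r}"
      by (intro set_eqI) (simp only: in_slice, auto)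
    moreover have "F z = 2 * r"
      by (simp add: F_def r_def)
    ultimately show "emeasure lborel (Pair z -` ?S) = ennreal (F0 z)"
      using F_nonneg[of z] by (auto simp: F0_def emeasure_lborel_Ioo)
  qed
  also have "\<dots> = ennreal (area a)"
  proof (rule nn_integral_has_integral_lborel)
    show "F0 \<in> borel_measurable borel"
      unfolding F0_def F_def cubic_def by measurable
    show "0 \<le> F0 z" for z
      using F_nonneg[of z] by (simp add: F0_def)
    show "(F0 has_integral area a) UNIV"
      using has_integral_area[OF assms] unfolding F0_def F_def Z_def
      by (subst has_integral_restrict_UNIV)
  qed
  finally show ?thesis .
qed

text \<open>Monotonicity along rays makes the superlevel sets invariant under dilations by factors \<open>\<ge> 1\<close>, so every
  component outside a level curve is unbounded.\<close>
lemma hill_K_part_star_shaped: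
  assumes "1 \<le> t"
  shows "hill_K_part f g x \<le> hill_K_part f g (t *\<^sub>R x)"
proof -
  obtain z w where x: "x = (z, w)"
    by (cases x)
  have sq: "v\<^sup>2 \<le> (t * v)\<^sup>2" for v :: real
    using assms by (intro iffD1[OF abs_le_square_iff]) (simp add: abs_mult mult_le_cancel_right1)
  have "cubic (z\<^sup>2) \<le> cubic ((t * z)\<^sup>2)"
    using sq[of z] cubic_less_iff[of "(t * z)\<^sup>2" "z\<^sup>2"] by linarith
  then show ?thesis
    using sq[of w] by (simp add: x hill_K_part_eq)
qed

lemma hill_K_part_continuous: "continuous_on S (hill_K_part f g)"
  unfolding hill_K_part_def case_prod_beta by (intro continuous_intros) simp_all

lemma bounded_sublevel: "bounded {x. hill_K_part f g x < a}"
proof -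
  have "{x. hill_K_part f g x < a} \<subseteq> cball 0 (sqrt (a / f)) \<times> cball 0 (sqrt (8 * a))"
  proof
    fix x assume "x \<in> {x. hill_K_part f g x < a}"
    then obtain z w where x: "x = (z, w)" and less: "hill_K_part f g (z, w) < a"
      by (cases x) simp
    have "g * z ^ 6 \<le> 0"
      using g_neg by (simp add: mult_le_0_iff)
    moreover have "0 \<le> f * z\<^sup>2" "0 \<le> w\<^sup>2 / 8"
      using f_pos by simp_all
    moreover have "w\<^sup>2 / 8 + f * z\<^sup>2 - g * z ^ 6 < a"
      using less by (simp add: hill_K_part_def)
    ultimately have "f * z\<^sup>2 \<le> a" "w\<^sup>2 \<le> 8 * a"
      by linarith+
    then have "z\<^sup>2 \<le> a / f" "w\<^sup>2 \<le> 8 * a"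
      using f_pos by (simp_all add: field_simps)
    then have "\<bar>z\<bar> \<le> sqrt (a / f)" "\<bar>w\<bar> \<le> sqrt (8 * a)"
      by (auto intro!: real_le_rsqrt)
    then show "x \<in> cball 0 (sqrt (a / f)) \<times> cball 0 (sqrt (8 * a))"
      by (simp add: x)
  qed
  then show ?thesis
    using bounded_subset[OF bounded_Times[OF bounded_cball bounded_cball]] by blast
qed

text \<open>A component of the complement of the curve that meets the sublevel set stays in it, since
  the energy cannot pass the value \<open>a\<close>, and is bounded with it. From a point of higher energy the
  outgoing ray never meets the curve.\<close>
lemma inside_level:
  assumes "0 \<le> a"
  shows "inside {x. hill_K_part f g x = a} = {x. hill_K_part f g x < a}"
proof -
  let ?K = "hill_K_part f g"
  let ?L = "{x. ?K x = a}"
  have "bounded (connected_component_set (- ?L) x)" if x: "?K x < a" for x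
  proof -
    let ?C = "connected_component_set (- ?L) x"
    have conn: "connected (?K ` ?C)"
      by (intro connected_continuous_image hill_K_part_continuous connected_connected_component)
    have "a \<notin> ?K ` ?C"
      using connected_component_subset[of "- ?L" x] by auto
    moreover have "x \<in> ?C"
      using x by (simp add: connected_component_refl_eq)
    moreover have "{?K x..?K y} \<subseteq> ?K ` ?C" if "x \<in> ?C" "y \<in> ?C" for y
      using that by (intro connected_contains_Icc[OF conn] imageI)
    ultimately have "a \<notin> {?K x..?K y}" if "y \<in> ?C" for y
      using that by blast
    then have "?K y < a" if "y \<in> ?C" for y
      using that x by (simp add: not_le)
    then show ?thesis
      by (intro bounded_subset[OF bounded_sublevel[of a]]) blast
  qed
  moreover have "\<not> bounded (connected_component_set (- ?L) x)" if x: "a < ?K x" for x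
  proof
    assume bdd: "bounded (connected_component_set (- ?L) x)"
    define R where "R = (\<lambda>t. t *\<^sub>R x) ` {1..}"
    have "connected R"
      unfolding R_def by (intro connected_continuous_image continuous_intros) simp
    moreover have "R \<subseteq> - ?L"
      using hill_K_part_star_shaped[of _ x] x unfolding R_def by fastforce
    moreover have "x \<in> R"
      unfolding R_def by (rule image_eqI[of _ _ 1]) auto
    ultimately have "R \<subseteq> connected_component_set (- ?L) x"
      by (intro connected_component_maximal)
    then have "bounded R"
      using bdd bounded_subset by blast
    then obtain B where B: "\<And>t. 1 \<le> t \<Longrightarrow> norm (t *\<^sub>R x) \<le> B"
      unfolding R_def bounded_iff by auto
    have "x \<noteq> 0"
      using x assms by (auto simp: hill_K_part_def zero_prod_def)
    then have "norm x > 0"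
      by simp
    moreover have "norm ((1 + \<bar>B\<bar> / norm x) *\<^sub>R x) = norm x + \<bar>B\<bar>"
      using \<open>x \<noteq> 0\<close> by (simp add: field_simps)
    moreover have "norm ((1 + \<bar>B\<bar> / norm x) *\<^sub>R x) \<le> B"
      by (rule B) simp
    ultimately show False
      by linarith
  qed
  ultimately show ?thesis
    unfolding inside_def by (auto simp: linorder_neq_iff)
qed

lemma area_0: "area 0 = 0"
  by (simp add: area_def)

lemma area_nonneg:
  assumes "0 \<le> a"
  shows "0 \<le> area a"
proof -
  have "strict_mono area"
    by (rule times_differentiable_on_inv(1)[OF area_smooth area_deriv area_rate_pos])
  then show ?thesis
    using assms strict_mono_less_eq[of area 0 a] by (simp add: area_0)
qed

lemma action_eq_area: "0 \<le> a \<Longrightarrow> action (hill_K_part f g) a = area a / (2 * pi)"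
  by (simp add: action_def inside_level measure_def emeasure_sublevel area_nonneg)

section \<open>The moment image\<close>

text \<open>Agrees with the action for \<open>a \<ge> 0\<close>, but unlike the action it is smooth and strictly
  increasing on the whole line, so that its inverse is smooth on an open set.\<close>
definition action_of_energy :: "real \<Rightarrow> real" where
  "action_of_energy a = area a / (2 * pi)"

lemma action_of_energy_smooth: "times_differentiable_on n UNIV action_of_energy"
  unfolding action_of_energy_def[abs_def] divide_inverse
  by (intro times_differentiable_on_mult times_differentiable_on_const area_smooth)

lemma action_of_energy_deriv: "(action_of_energy has_field_derivative area_rate a / (2 * pi)) (at a)"
  unfolding action_of_energy_def[abs_def] by (intro DERIV_cdivide area_deriv)

lemma action_rate_pos: "0 < area_rate a / (2 * pi)"
  by (simp add: area_rate_pos)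

lemmas action_of_energy_inverse_facts =
  times_differentiable_on_inv[OF action_of_energy_smooth action_of_energy_deriv action_rate_pos]

lemma action_of_energy_0: "action_of_energy 0 = 0"
  by (simp add: action_of_energy_def area_0)

text \<open>The curve is the graph of \<open>\<phi> x = I (m - inv I x)\<close>, where \<open>I\<close> is the action. At \<open>x = I a\<close> its
  slope is \<open>- I' (m - a) / I' a\<close>, and a decreasing \<open>I'\<close> makes this decrease in \<open>a\<close>.\<close>
lemma bounds_convex_toric_domain_hill_K:
  assumes "0 < m"
  shows "bounds_convex_toric_domain (hill_K_part f g) (hill_K_part f g) {x. hill_K f g x = m}"
proof -
  define c where "c = action_of_energy m"
  define \<phi> where "\<phi> = (\<lambda>x. action_of_energy (m - inv action_of_energy x))"
  have mono: "strict_mono action_of_energy"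
    by (rule action_of_energy_inverse_facts(1))
  have less_iff: "action_of_energy a < action_of_energy b \<longleftrightarrow> a < b" for a b
    by (rule strict_mono_less[OF mono])
  have le_iff: "action_of_energy a \<le> action_of_energy b \<longleftrightarrow> a \<le> b" for a b
    by (rule strict_mono_less_eq[OF mono])
  have inv: "inv action_of_energy (action_of_energy a) = a" for a
    by (rule inv_f_f[OF strict_mono_imp_inj_on[OF mono]])
  have c: "0 < c"
    using less_iff[of 0 m] assms by (simp add: c_def action_of_energy_0)
  have cover: "{0..c} = action_of_energy ` {0..m}"
  proof
    have cont: "continuous_on {0..m} action_of_energy"
      by (rule all_times_differentiable_on_continuous[OF action_of_energy_smooth])
    show "{0..c} \<subseteq> action_of_energy ` {0..m}"
    proof
      fix x assume "x \<in> {0..c}"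
      then have "\<exists>a\<ge>0. a \<le> m \<and> action_of_energy a = x"
        using assms cont by (intro IVT') (simp_all add: action_of_energy_0 c_def)
      then show "x \<in> action_of_energy ` {0..m}"
        by auto
    qed
    show "action_of_energy ` {0..m} \<subseteq> {0..c}"
      using le_iff[of 0] le_iff[of _ m] by (auto simp: action_of_energy_0 c_def)
  qed
  have \<phi>_action: "\<phi> (action_of_energy a) = action_of_energy (m - a)" for a
    by (simp add: \<phi>_def inv)
  have smooth: "smooth_fun_on {0..c} \<phi>"
  proof -
    have "times_differentiable_on n (range action_of_energy) \<phi>" for n
      unfolding \<phi>_def
      by (rule times_differentiable_on_compose[OF action_of_energy_smooth
            times_differentiable_on_diff[OF times_differentiable_on_const action_of_energy_inverse_facts(4)]])
        simp
    from all_times_differentiable_on_imp_smooth[OF this action_of_energy_inverse_facts(2)]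
    show ?thesis
      unfolding smooth_fun_on_def using action_of_energy_inverse_facts(2)
      by (intro exI[of _ "range action_of_energy"] exI[of _ \<phi>]) (auto simp: cover)
  qed
  have antimono: "antimono_on {0..c} \<phi>"
    by (intro monotone_onI) (auto simp: cover \<phi>_action le_iff)
  have concave: "concave_on {0..c} \<phi>"
  proof -
    \<comment> \<open>The derivative of \<open>- \<phi>\<close>; the factors \<open>2 \<pi>\<close> cancel in the quotient of the two rates.\<close>
    define s where "s = (\<lambda>x. area_rate (m - inv action_of_energy x) / area_rate (inv action_of_energy x))"
    have "convex_on {0..c} (\<lambda>x. - \<phi> x)"
    proof (rule convex_on_realI)
      fix x assume "x \<in> {0..c}"
      then obtain a where x: "x = action_of_energy a"
        using cover by auto
      have "((\<lambda>x. m - inv action_of_energy x) has_field_derivative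
          0 - inverse (area_rate a / (2 * pi))) (at x)"
        unfolding x by (intro DERIV_diff DERIV_const action_of_energy_inverse_facts(3))
      from DERIV_minus[OF DERIV_chain2[OF action_of_energy_deriv this]]
      show "((\<lambda>x. - \<phi> x) has_field_derivative s x) (at x)"
        by (simp add: \<phi>_def s_def x inv field_simps)
    next
      fix x y assume xy: "x \<in> {0..c}" "y \<in> {0..c}" "x \<le> y"
      then obtain a b where ab: "x = action_of_energy a" "y = action_of_energy b" "0 \<le> a" "b \<le> m"
        using cover by auto
      have "a \<le> b"
        using xy(3) by (simp add: ab le_iff)
      then have "area_rate (m - a) \<le> area_rate (m - b)" "area_rate b \<le> area_rate a"
        using ab by (auto intro: area_rate_antimono)
      then show "s x \<le> s y"
        using area_rate_pos by (simp add: s_def ab inv frac_le less_imp_le)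
    qed simp
    then show ?thesis
      by (simp add: concave_on_def)
  qed
  have action: "action (hill_K_part f g) a = action_of_energy a" if "0 \<le> a" for a
    using that by (simp add: action_eq_area action_of_energy_def)
  have "moment_map (hill_K_part f g) (hill_K_part f g) ` {x. hill_K f g x = m}
      = {(action_of_energy a, action_of_energy (m - a)) | a. a \<in> {0..m}}"
    unfolding moment_image_hill[OF f_pos g_neg assms]
    by (intro Collect_cong ex_cong1) (auto simp: action)
  also have "\<dots> = {(x, \<phi> x) | x. x \<in> {0..c}}"
    unfolding cover by (auto simp: \<phi>_action)
  finally have image: "moment_map (hill_K_part f g) (hill_K_part f g) ` {x. hill_K f g x = m}
      = {(x, \<phi> x) | x. x \<in> {0..c}}" .
  have "\<phi> c = 0"
    unfolding c_def by (simp add: \<phi>_action action_of_energy_0)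
  then show ?thesis
    unfolding bounds_convex_toric_domain_def using c smooth antimono concave image by blast
qed

end

section \<open>Regularization at the collision\<close>

text \<open>Over \<open>z = 0\<close> the regularized Hamiltonian is a limit of values \<open>K - m\<close>, and \<open>K\<close> is a
  polynomial; the limit is unique because \<open>z = 0\<close> is approached by points with \<open>z \<noteq> 0\<close>.\<close>
lemma levi_civita_hamiltonian_hill:
  "levi_civita_hamiltonian (hill_hamiltonian m g) (- f) x = hill_K f g x - m"
proof -
  obtain z w where x: "x = (z, w)"
    by (cases x)
  show ?thesis
  proof (cases "z = 0")
    case False
    then show ?thesis
      by (simp add: x levi_civita_hamiltonian_def levi_civita_pullback_hill)
  next
    case True
    let ?A = "{y :: complex \<times> complex. fst y \<noteq> 0}"
    have "((\<lambda>y. hill_K f g y - m) \<longlongrightarrow> hill_K f g x - m) (at x within ?A)"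
    proof -
      have "continuous_on UNIV (hill_K f g)"
        unfolding hill_K_def case_prod_beta by (intro continuous_intros) simp_all
      then have "isCont (hill_K f g) x"
        using continuous_on_eq_continuous_at[OF open_UNIV] by blast
      then have "(hill_K f g \<longlongrightarrow> hill_K f g x) (at x within ?A)"
        unfolding isCont_def by (rule tendsto_within_subset[OF _ subset_UNIV])
      then show ?thesis
        by (intro tendsto_diff tendsto_const)
    qed
    moreover have "\<forall>\<^sub>F y in at x within ?A.
        hill_K f g y - m = levi_civita_pullback (hill_hamiltonian m g) (- f) y"
      unfolding eventually_at_filter
      by (intro always_eventually) (auto simp: levi_civita_pullback_hill)
    ultimately have lim: "(levi_civita_pullback (hill_hamiltonian m g) (- f) \<longlongrightarrow> hill_K f g x - m)
        (at x within ?A)"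
      by (rule Lim_transform_eventually)
    have "x islimpt ?A"
      unfolding islimpt_approachable
    proof (intro allI impI)
      fix e :: real
      assume "0 < e"
      then show "\<exists>y\<in>?A. y \<noteq> x \<and> dist y x < e"
        using True by (intro bexI[of _ "(of_real (e / 2), w)"]) (auto simp: x dist_Pair_Pair dist_norm)
    qed
    then have "\<not> trivial_limit (at x within ?A)"
      by (simp add: trivial_limit_within)
    then show ?thesis
      using tendsto_Lim[OF _ lim] True by (simp add: x levi_civita_hamiltonian_def)
  qed
qed

theorem theorem2:
  fixes m g f :: real
  assumes "m > 0" and "g < 0" and "f > 0"
  shows "regularized_energy_level (hill_hamiltonian m g) (- f) = {x. hill_K f g x = m} \<and>
    bounds_convex_toric_domain (hill_K_part f g) (hill_K_part f g)
      (regularized_energy_level (hill_hamiltonian m g) (- f))"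
proof -
  interpret hill_parameters f g
    by unfold_locales (use assms in auto)
  have "regularized_energy_level (hill_hamiltonian m g) (- f) = {x. hill_K f g x = m}"
    by (simp add: regularized_energy_level_def levi_civita_hamiltonian_hill)
  then show ?thesis
    using bounds_convex_toric_domain_hill_K[OF \<open>m > 0\<close>] by simp
qed

end
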